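(* Let $t\ge 1$ be a fixed integer. If $s=\Omega(n^{1/t}(t-1)!)$ (i.e., $s\ge c_0\, n^{1/t}(t-1)!$ for some constant $c_0>0$), then $\lambda(s,n)=\Omega(n^2 s/(t-1)!)$ and $\lambda(s,n)=O(n^2 s)$, with asymptotic notation as $n\to\infty$.
   Context: A sequence $S$ over an alphabet is an order-$s$ Davenport–Schinzel sequence if it contains no immediate repetition (no two equal consecutive symbols) and contains no alternating subsequence $a\,b\,a\,b\cdots$ (with $a\neq b$) of length $s+2$. Let $DS(s,n)$ be the set of order-$s$ Davenport–Schinzel sequences using exactly $n$ distinct symbols, and $\lambda(s,n)=\max\{|S| : S\in DS(s,n)\}$, where $|S|$ is the length of $S$. *)

theory Defs
  imports Complex_Main "HOL-Library.Sublist" "HOL-Library.Landau_Symbols"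
begin

definition alternation :: "'a \<Rightarrow> 'a \<Rightarrow> nat \<Rightarrow> 'a list" where
  "alternation a b k = map (\<lambda>i. if even i then a else b) [0..<k]"

text \<open>Subsequences (\<^const>\<open>subseq\<close>) need not be contiguous.\<close>

definition davenport_schinzel :: "nat \<Rightarrow> 'a list \<Rightarrow> bool" where
  "davenport_schinzel s S \<longleftrightarrow>
     distinct_adj S \<and> (\<forall>a b. a \<noteq> b \<longrightarrow> \<not> subseq (alternation a b (s + 2)) S)"

text \<open>
  The alphabet is fixed to be \<^typ>\<open>nat\<close>; since the property is invariant under injective
  renaming of symbols, this does not affect the possible lengths.
\<close>

definition DS :: "nat \<Rightarrow> nat \<Rightarrow> nat list set" where
  "DS s n = {S. davenport_schinzel s S \<and> card (set S) = n}"

text \<open>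
  For \<open>s = 0\<close> and \<open>n \<ge> 2\<close> the set \<^term>\<open>DS s n\<close> is empty and the maximum is unspecified.
\<close>

definition ds_max :: "nat \<Rightarrow> nat \<Rightarrow> nat" where
  "ds_max s n = Max (length ` DS s n)"

end

theory Submission
  imports Defs "HOL-Algebra.Algebraic_Closure_Type" "HOL-Library.Z2"
begin

text \<open>
  Upper bound: each ordered pair of symbols is adjacent at most \<open>s\<close> times, since \<open>m\<close> occurrences
  of \<open>ab\<close> as a factor yield an alternation of length \<open>2m\<close>.

  Lower bound: let \<open>q\<close> be a power of two of order \<open>n\<^sup>1\<^sup>/\<^sup>t\<close>, and let the symbols be \<open>q\<^sup>t\<close> polynomials of
  degree less than \<open>t\<close> over the field with \<open>q\<close> elements. Their graphs give \<open>q\<^sup>2\<close> blocks of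
  \<open>q\<^sup>t\<^sup>-\<^sup>1\<close> symbols each, with every symbol in \<open>q\<close> blocks and two symbols in at most \<open>t - 1\<close> common
  blocks. Concatenating sequences built recursively on the blocks therefore costs a pair only
  \<open>2q\<close> alternations plus those inside its common blocks. For \<open>t = 1\<close> concatenate
  \<open>(ab)\<^sup>k\<close> over all pairs. The result has length of order \<open>q\<^sup>2\<^sup>t k\<close> and alternations of length
  \<open>O(q + k)\<close>, so \<open>k\<close> may be chosen of order \<open>s\<close>. Powers of two replace primes to avoid Bertrand's
  postulate: the field is found inside the algebraic closure of the field with two elements.
\<close>

subsection \<open>Alternation length\<close>

text \<open>For distinct \<open>a\<close> and \<open>b\<close> this is the length of the longest
  alternation of the two, starting with either, among the subsequences of \<open>S\<close>: one
  letter can be taken from each run of the restriction to \<open>a\<close> and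
  \<open>b\<close>.\<close>

definition alt_length :: "'a \<Rightarrow> 'a \<Rightarrow> 'a list \<Rightarrow> nat" where
  "alt_length a b S = length (remdups_adj (filter (\<lambda>x. x = a \<or> x = b) S))"

text \<open>Counting changes between neighbours rather than runs makes the quantity superadditive
  under concatenation, where two runs may merge at the junction. Truncated subtraction gives 0 for
  the empty list.\<close>

definition num_steps :: "'a list \<Rightarrow> nat" where
  "num_steps S = length (remdups_adj S) - 1"

text \<open>The case that matters is \<open>xs = y # xs'\<close> with the two heads matched. If
  \<open>ys\<close> does not start with \<open>y\<close>, the right side gains a run and the left at
  most one. If it does, either \<open>xs'\<close> also starts with \<open>y\<close> and neither side
  gains, or \<open>xs'\<close> embeds behind the head of \<open>ys\<close>, so that all of
  \<open>xs\<close> already embeds in \<open>ys\<close>.\<close>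

lemma length_remdups_adj_subseq_mono:
  "subseq xs ys \<Longrightarrow> length (remdups_adj xs) \<le> length (remdups_adj ys)"
proof (induction ys arbitrary: xs)
  case (Cons y ys)
  show ?case
  proof (cases "subseq xs ys")
    case True
    then have "length (remdups_adj xs) \<le> length (remdups_adj ys)" by (rule Cons.IH)
    also have "\<dots> \<le> length (remdups_adj (y # ys))" by (cases ys) (auto)
    finally show ?thesis .
  next
    case False
    then obtain xs' where xs: "xs = y # xs'" and sub: "subseq xs' ys"
      using Cons.prems by (metis list_emb_Nil neq_Nil_conv subseq_Cons2_neq subseq_Cons2')
    show ?thesis
    proof (cases "ys \<noteq> [] \<and> hd ys = y")
      case hd_ys: True
      then obtain zs where ys: "ys = y # zs" by (cases ys) auto
      show ?thesis
      proof (cases "xs' \<noteq> [] \<and> hd xs' = y")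
        case True
        then show ?thesis using Cons.IH[OF sub] xs ys by (cases xs') auto
      next
        case False
        then have "subseq xs' zs"
          using sub ys by (cases xs') (auto split: if_splits)
        then have "subseq (y # xs') ys" by (simp add: ys)
        from Cons.IH[OF this] show ?thesis using xs ys by simp
      qed
    next
      case False
      then have "length (remdups_adj (y # ys)) = Suc (length (remdups_adj ys))"
        by (cases ys) auto
      moreover have "length (remdups_adj (y # xs')) \<le> Suc (length (remdups_adj xs'))"
        by (cases xs') auto
      ultimately show ?thesis using Cons.IH[OF sub] xs by simp
    qed
  qed
qed simp

lemma subseq_remdups_adj: "subseq (remdups_adj xs) xs"
  by (induction xs rule: remdups_adj.induct) (auto intro: list_emb_Cons)

lemma length_remdups_adj_append_le:
  "length (remdups_adj (xs @ ys)) \<le> length (remdups_adj xs) + length (remdups_adj ys)"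
proof (induction xs rule: remdups_adj.induct)
  case (2 x)
  then show ?case by (cases ys) auto
qed auto

lemma num_steps_append_ge: "num_steps xs + num_steps ys \<le> num_steps (xs @ ys)"
proof -
  have "length (remdups_adj xs) + length (remdups_adj ys) \<le> Suc (length (remdups_adj (xs @ ys)))"
  proof (induction xs rule: remdups_adj.induct)
    case (2 x)
    then show ?case by (cases ys) auto
  qed auto
  moreover have "xs = [] \<or> length (remdups_adj xs) \<ge> 1" "ys = [] \<or> length (remdups_adj ys) \<ge> 1"
    using remdups_adj_length_ge1 by fastforce+
  ultimately show ?thesis by (auto simp: num_steps_def)
qed

lemma num_steps_concat_ge:
  "(\<Sum>x\<leftarrow>xs. num_steps (f x)) \<le> num_steps (concat (map f xs))"
proof (induction xs)
  case (Cons x xs)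
  then show ?case using num_steps_append_ge[of "f x" "concat (map f xs)"] by simp
qed simp

lemma alt_length_append_le: "alt_length a b (xs @ ys) \<le> alt_length a b xs + alt_length a b ys"
  by (simp add: alt_length_def length_remdups_adj_append_le)

lemma alt_length_concat_le:
  "alt_length a b (concat (map f xs)) \<le> (\<Sum>x\<leftarrow>xs. alt_length a b (f x))"
proof (induction xs)
  case (Cons x xs)
  then show ?case using alt_length_append_le[of a b "f x" "concat (map f xs)"] by simp
qed (simp add: alt_length_def)

lemma alt_length_commute: "alt_length a b S = alt_length b a S"
  by (simp add: alt_length_def disj_commute)

lemma alt_length_le_length: "alt_length a b S \<le> length S"
  unfolding alt_length_def by (meson le_trans length_filter_le remdups_adj_length)

lemma alt_length_subseq_mono: "subseq S T \<Longrightarrow> alt_length a b S \<le> alt_length a b T"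
  unfolding alt_length_def by (intro length_remdups_adj_subseq_mono subseq_filter)

lemma alt_length_le_one:
  assumes "b \<notin> set S"
  shows "alt_length a b S \<le> (if a \<in> set S then 1 else 0)"
proof -
  have eq: "filter (\<lambda>x. x = a \<or> x = b) S = filter (\<lambda>x. x = a) S"
    using assms by (intro filter_cong) auto
  have "filter (\<lambda>x. x = a) S = replicate (length (filter (\<lambda>x. x = a) S)) a"
    by (simp add: replicate_length_same)
  then have "length (remdups_adj (filter (\<lambda>x. x = a) S)) \<le> 1"
    using remdups_adj_replicate by (metis le_numeral_extra(4) length_0_conv One_nat_def length_Cons zero_le_one list.size(3))
  moreover have "a \<notin> set S \<Longrightarrow> filter (\<lambda>x. x = a) S = []"
    by (auto simp: filter_empty_conv)
  ultimately show ?thesis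
    unfolding alt_length_def eq by auto
qed

text \<open>A block that misses one of the two symbols contributes at most a single run, and only
  blocks with both can cost \<open>M\<close>. The \<open>of_bool\<close> form turns into counts of
  blocks when summed.\<close>

lemma alt_length_cases:
  assumes "\<And>a b. a \<in> V \<Longrightarrow> b \<in> V \<Longrightarrow> a \<noteq> b \<Longrightarrow> alt_length a b S \<le> M"
    and "set S \<subseteq> V" and "a \<noteq> b"
  shows "alt_length a b S \<le> of_bool (a \<in> V) + of_bool (b \<in> V) + of_bool (a \<in> V \<and> b \<in> V) * M"
proof -
  consider "a \<in> V" "b \<in> V" | "b \<notin> set S" "b \<notin> V" | "a \<notin> set S" "a \<notin> V"
    using assms by blast
  then show ?thesis
  proof cases
    case 1
    then show ?thesis using assms(1)[of a b] assms(3) by simp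
  next
    case 2
    then show ?thesis using alt_length_le_one[of b S a] assms by (auto split: if_splits)
  next
    case 3
    then show ?thesis using alt_length_le_one[of a S b] assms
      by (auto simp: alt_length_commute split: if_splits)
  qed
qed

section \<open>Alternations as subsequences\<close>

lemma alternation_Suc_Suc: "alternation a b (Suc (Suc k)) = a # b # alternation a b k"
  by (rule nth_equalityI) (auto simp: alternation_def nth_Cons split: nat.split simp del: upt_Suc)

lemma subseq_alternation_le:
  assumes "k \<le> m"
  shows "subseq (alternation a b k) (alternation a b m)"
proof -
  obtain d where "m = k + d" using assms by (auto simp: le_iff_add)
  then have "prefix (alternation a b k) (alternation a b m)"
    using upt_add_eq_append[of 0 k d] by (simp add: alternation_def)
  then show ?thesis by (rule prefix_imp_subseq)
qed

lemma distinct_adj_alternation: "a \<noteq> b \<Longrightarrow> distinct_adj (alternation a b k)"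
  unfolding alternation_def distinct_adj_conv_nth by auto

lemma alternation_subseq_imp_le:
  assumes "a \<noteq> b" "subseq (alternation a b m) S"
  shows "m \<le> alt_length a b S"
proof -
  have "alt_length a b (alternation a b m) \<le> alt_length a b S"
    using assms(2) by (rule alt_length_subseq_mono)
  moreover have "filter (\<lambda>x. x = a \<or> x = b) (alternation a b m) = alternation a b m"
    by (rule filter_True) (auto simp: alternation_def)
  moreover have "remdups_adj (alternation a b m) = alternation a b m"
    using distinct_adj_alternation[OF assms(1)] by (simp add: distinct_adj_altdef)
  ultimately show ?thesis by (simp add: alt_length_def) (simp add: alternation_def)
qed

text \<open>Occurrences of the factor \<open>ab\<close> cannot overlap, so their letters read in
  order form an alternation. After an occurrence the induction skips both letters, since none can
  start at \<open>b\<close>.\<close>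

lemma subseq_alternation_count_adjacent:
  assumes "a \<noteq> b"
  shows "subseq (alternation a b (2 * count_list (zip S (tl S)) (a, b))) S"
proof (induction S rule: induct_list012)
  case (3 x y zs)
  show ?case
  proof (cases "x = a \<and> y = b")
    case True
    have "count_list (zip (y # zs) zs) (a, b) = count_list (zip zs (tl zs)) (a, b)"
      using True assms by (cases zs) auto
    then show ?thesis using True 3(1) by (simp add: alternation_Suc_Suc)
  next
    case False
    then show ?thesis using 3(2) by auto
  qed
qed (auto simp: alternation_def)

subsection \<open>The trivial upper bound\<close>

lemma davenport_schinzel_length_le:
  assumes "davenport_schinzel s S"
  shows "length S \<le> 1 + (card (set S))\<^sup>2 * s"
proof -
  let ?Z = "zip S (tl S)" and ?X = "set S \<times> set S"
  have sub: "set ?Z \<subseteq> ?X"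
    by (cases S) (auto dest: set_zip_leftD set_zip_rightD)
  have cnt: "count_list ?Z p \<le> s" if "p \<in> ?X" for p
  proof (cases p)
    case (Pair a b)
    show ?thesis
    proof (cases "a = b")
      case True
      have "(a, a) \<notin> set ?Z"
      proof
        assume "(a, a) \<in> set ?Z"
        then obtain i where i: "i < length (tl S)" "S ! i = a" "tl S ! i = a"
          by (auto simp: set_zip)
        then have "Suc i < length S" "S ! Suc i = S ! i" by (auto simp: nth_tl)
        moreover have "distinct_adj S" using assms by (simp add: davenport_schinzel_def)
        ultimately show False
          by (metis distinct_adj_conv_nth One_nat_def Suc_eq_plus1 less_diff_conv)
      qed
      then show ?thesis using Pair True by simp
    next
      case False
      show ?thesis
      proof (rule ccontr)
        let ?m = "count_list ?Z p"
        assume "\<not> ?m \<le> s"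
        \<comment> \<open>At least \<open>s + 1\<close> occurrences give an alternation of length at
          least \<open>2 * s + 2\<close>.\<close>
        then have "s + 2 \<le> 2 * ?m" by linarith
        then have "subseq (alternation a b (s + 2)) (alternation a b (2 * ?m))"
          by (rule subseq_alternation_le)
        moreover have "subseq (alternation a b (2 * ?m)) S"
          using subseq_alternation_count_adjacent[OF False, of S] Pair by simp
        ultimately show False
          using assms False by (meson davenport_schinzel_def subseq_order.trans)
      qed
    qed
  qed
  have "length S - 1 = length ?Z" by simp
  also have "\<dots> = (\<Sum>p\<in>?X. count_list ?Z p)" using sub by (simp add: sum_count_set)
  also have "\<dots> \<le> (\<Sum>p\<in>?X. s)" using cnt by (rule sum_mono)
  also have "\<dots> = (card (set S))\<^sup>2 * s" by (simp add: card_cartesian_product power2_eq_square)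
  finally show ?thesis by linarith
qed

text \<open>\<open>DS s n\<close> itself may be infinite, the alphabet being all of
  \<open>nat\<close>; only the lengths are bounded, which is what \<open>Max\<close>
  requires.\<close>

lemma finite_lengths_DS: "finite (length ` DS s n)"
proof (rule finite_subset)
  show "length ` DS s n \<subseteq> {..1 + n\<^sup>2 * s}"
    using davenport_schinzel_length_le by (auto simp: DS_def)
qed simp

lemma length_le_ds_max: "S \<in> DS s n \<Longrightarrow> length S \<le> ds_max s n"
  unfolding ds_max_def by (intro Max_ge finite_lengths_DS) auto

lemma ds_max_le:
  assumes "DS s n \<noteq> {}"
  shows "ds_max s n \<le> 1 + n\<^sup>2 * s"
  unfolding ds_max_def using assms davenport_schinzel_length_le
  by (intro Max.boundedI finite_lengths_DS) (auto simp: DS_def)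

subsection \<open>Block designs from polynomials\<close>

text \<open>The subfield consists of the roots of \<open>X\<^sup>q - X\<close>, where \<open>q = 2\<^sup>j\<close>.\<close>

lemma subfield_of_card_power_two:
  fixes j :: nat
  assumes "j \<ge> 1"
  obtains K :: "bit alg_closure set"
  where "finite K" "card K = 2 ^ j"
    and "\<And>x y. x \<in> K \<Longrightarrow> y \<in> K \<Longrightarrow> x + y \<in> K"
    and "\<And>x y. x \<in> K \<Longrightarrow> y \<in> K \<Longrightarrow> x * y \<in> K"
    and "\<And>x y. x \<in> K \<Longrightarrow> y \<in> K \<Longrightarrow> x - y \<in> K"
proof -
  define q :: nat where "q = 2 ^ j"
  have q: "q \<ge> 2" using assms power_increasing[of 1 j "2 :: nat"] by (simp add: q_def)
  have two: "(2 :: bit alg_closure) = 0"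
  proof -
    have "(2 :: bit alg_closure) = to_ac (2 :: bit)" by (simp only: to_ac_numeral)
    also have "(2 :: bit) = 0" by simp
    finally show ?thesis by simp
  qed
  have qz: "of_nat q = (0 :: bit alg_closure)"
    using assms by (simp add: q_def two)
  \<comment> \<open>Iterated squaring is additive, as the cross term \<open>2 * x * y\<close>
    vanishes in characteristic two.\<close>
  have add_pow: "(x + y) ^ (2 ^ i) = x ^ (2 ^ i) + y ^ (2 ^ i)" for x y :: "bit alg_closure" and i
  proof (induction i)
    case (Suc i)
    have "(x + y) ^ (2 ^ Suc i) = ((x + y) ^ (2 ^ i))\<^sup>2"
      by (simp add: power_mult[symmetric] mult.commute)
    also have "\<dots> = (x ^ (2 ^ i))\<^sup>2 + (y ^ (2 ^ i))\<^sup>2"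
      by (simp add: Suc power2_sum two)
    finally show ?case by (simp add: power_mult[symmetric] mult.commute)
  qed simp
  define P :: "bit alg_closure poly" where "P = monom 1 q - monom 1 1"
  define K where "K = {x. poly P x = 0}"
  have K: "x \<in> K \<longleftrightarrow> x ^ q = x" for x
    by (simp add: K_def P_def poly_monom)
  have degP: "degree P = q"
    unfolding P_def diff_conv_add_uminus using q
    by (subst degree_add_eq_left) (auto simp: degree_monom_eq)
  then have P0: "P \<noteq> 0" using q by auto
  \<comment> \<open>The leading term of the derivative has coefficient \<open>q\<close>, which is 0
    in the field.\<close>
  have dP: "pderiv P = -1"
    unfolding P_def pderiv_diff pderiv_monom using q
    by (simp add: qz monom_0 one_pCons)
  have "card K = q"
  proof -
    obtain A c where A: "size A = degree P" "P = smult c (\<Prod>x\<in>#A. [:-x, 1:])"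
      using alg_closed_imp_factorization[OF P0] by blast
    have "c \<noteq> 0" using A(2) P0 by auto
    \<comment> \<open>A double root of \<open>P\<close> would be a root of its derivative, the
      constant -1. Hence the \<open>q\<close> roots in \<open>A\<close> are distinct.\<close>
    have cnt: "count A x \<le> 1" for x
    proof (rule ccontr)
      assume "\<not> count A x \<le> 1"
      then have "x \<in># A" "x \<in># A - {#x#}"
        by (auto simp flip: count_greater_zero_iff)
      then obtain B where "A = add_mset x (add_mset x B)"
        by (metis insert_DiffM)
      then have "P = [:-x, 1:] * ([:-x, 1:] * smult c (\<Prod>x\<in>#B. [:-x, 1:]))"
        by (simp only: A(2) image_mset_add_mset prod_mset.add_mset mult_smult_right)
      then have "poly (pderiv P) x = 0" by (simp only: pderiv_mult) simp
      then show False by (simp add: dP)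
    qed
    have "K = set_mset A"
      unfolding K_def A(2) using \<open>c \<noteq> 0\<close> by (auto simp: poly_prod_mset prod_mset_zero_iff)
    moreover have "card (set_mset A) = size A"
    proof -
      have "count A x = 1" if "x \<in> set_mset A" for x
        using that cnt[of x] by (simp flip: count_greater_zero_iff)
      then show ?thesis by (simp add: size_multiset_overloaded_eq)
    qed
    ultimately show ?thesis using A(1) degP by simp
  qed
  moreover have "finite K" unfolding K_def using P0 by (rule poly_roots_finite)
  moreover have "x + y \<in> K" if "x \<in> K" "y \<in> K" for x y
    using that add_pow[of x y j] by (simp add: K q_def)
  moreover have "x * y \<in> K" if "x \<in> K" "y \<in> K" for x y
    using that by (simp add: K power_mult_distrib)
  moreover have "x - y \<in> K" if "x \<in> K" "y \<in> K" for x y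
  proof -
    have "x - y = x + y"
      by (metis add_diff_cancel_right' diff_diff_eq2 mult_2 mult_zero_left two diff_zero)
    then show ?thesis using that add_pow[of x y j] unfolding K q_def by (simp only:)
  qed
  ultimately show thesis using that unfolding q_def by blast
qed

text \<open>These are the polynomials of degree less than \<open>t\<close> with coefficients in
  \<open>K\<close>, together with 0. \<open>K\<close> is a set because the finite field lives inside
  the algebraic closure and is not a type of its own.\<close>

definition polys_over :: "'a::zero set \<Rightarrow> nat \<Rightarrow> 'a poly set" where
  "polys_over K t = {p. (\<forall>i<t. coeff p i \<in> K) \<and> (\<forall>i\<ge>t. coeff p i = 0)}"

lemma polys_over_0: "polys_over K 0 = {0}"
  by (auto simp: polys_over_def poly_eq_iff)

lemma polys_over_Suc: "polys_over K (Suc t) = (\<lambda>(c, p). pCons c p) ` (K \<times> polys_over K t)"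
proof (intro equalityI subsetI)
  fix p assume p: "p \<in> polys_over K (Suc t)"
  obtain c r where [simp]: "p = pCons c r" by (cases p)
  have "c \<in> K" using p by (auto simp: polys_over_def dest: spec[of _ 0])
  moreover have "r \<in> polys_over K t"
    unfolding polys_over_def
  proof (intro CollectI conjI allI impI)
    fix i
    show "coeff r i \<in> K" if "i < t"
      using p that by (auto simp: polys_over_def dest: spec[of _ "Suc i"])
    show "coeff r i = 0" if "t \<le> i"
      using p that by (auto simp: polys_over_def dest: spec[of _ "Suc i"])
  qed
  ultimately show "p \<in> (\<lambda>(c, p). pCons c p) ` (K \<times> polys_over K t)" by auto
next
  fix p assume "p \<in> (\<lambda>(c, p). pCons c p) ` (K \<times> polys_over K t)"
  then show "p \<in> polys_over K (Suc t)"
    by (auto simp: polys_over_def coeff_pCons split: nat.splits)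
qed

lemma card_polys_over:
  assumes "finite K"
  shows "finite (polys_over K t)" "card (polys_over K t) = card K ^ t"
proof -
  have "finite (polys_over K t) \<and> card (polys_over K t) = card K ^ t"
  proof (induction t)
    case (Suc t)
    have "inj_on (\<lambda>(c, p). pCons c p) (K \<times> polys_over K t)" by (auto simp: inj_on_def)
    then show ?case using Suc assms by (simp add: polys_over_Suc card_image card_cartesian_product)
  qed (simp add: polys_over_0)
  then show "finite (polys_over K t)" "card (polys_over K t) = card K ^ t" by auto
qed

text \<open>
  The elements of \<open>V\<close> stand for the polynomials of degree at most \<open>t\<close> over the field with
  \<open>q\<close> elements; the block of \<open>(x, y)\<close> consists of the polynomials that take the value \<open>y\<close> at \<open>x\<close>.
\<close>

lemma polynomial_block_design:
  fixes V :: "'a set"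
  assumes "j \<ge> 1" and q: "q = (2::nat) ^ j" and "finite V" "card V = q ^ Suc t"
  obtains B :: "nat \<Rightarrow> 'a set"
  where "\<And>i. i < q\<^sup>2 \<Longrightarrow> B i \<subseteq> V" "\<And>i. i < q\<^sup>2 \<Longrightarrow> card (B i) = q ^ t"
    and "\<And>a. card {i. i < q\<^sup>2 \<and> a \<in> B i} \<le> q"
    and "\<And>a b. a \<noteq> b \<Longrightarrow> card {i. i < q\<^sup>2 \<and> a \<in> B i \<and> b \<in> B i} \<le> t"
proof -
  obtain K :: "bit alg_closure set" where K: "finite K" "card K = q"
    and cl: "\<And>x y. x \<in> K \<Longrightarrow> y \<in> K \<Longrightarrow> x + y \<in> K"
      "\<And>x y. x \<in> K \<Longrightarrow> y \<in> K \<Longrightarrow> x * y \<in> K"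
      "\<And>x y. x \<in> K \<Longrightarrow> y \<in> K \<Longrightarrow> x - y \<in> K"
    using subfield_of_card_power_two[OF assms(1)] q by metis
  have "card K \<noteq> 0" using K q by simp
  then have "0 \<in> K" using cl(3) by (metis card.empty diff_self ex_in_conv)
  have poly_K: "poly p x \<in> K" if "p \<in> polys_over K d" "x \<in> K" for p x d
    using that
  proof (induction d arbitrary: p)
    case (Suc d)
    then show ?case using cl by (auto simp: polys_over_Suc)
  qed (use \<open>0 \<in> K\<close> in \<open>simp add: polys_over_0\<close>)
  obtain \<phi> where \<phi>: "bij_betw \<phi> V (polys_over K (Suc t))"
    using finite_same_card_bij[of V "polys_over K (Suc t)"] card_polys_over[OF K(1), of "Suc t"] assms K
    by auto
  obtain \<psi> where \<psi>: "bij_betw \<psi> {..<q\<^sup>2} (K \<times> K)"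
    using finite_same_card_bij[of "{..<q\<^sup>2}" "K \<times> K"] K by (auto simp: card_cartesian_product power2_eq_square)
  have \<psi>_inj: "inj_on \<psi> {..<q\<^sup>2}" and \<psi>_im: "\<And>i. i < q\<^sup>2 \<Longrightarrow> \<psi> i \<in> K \<times> K"
    using \<psi> by (auto simp: bij_betw_def)
  have \<phi>_inj: "inj_on \<phi> V" and \<phi>_im: "\<phi> ` V = polys_over K (Suc t)"
    using \<phi> by (auto simp: bij_betw_def)
  define B where "B i = {v\<in>V. poly (\<phi> v) (fst (\<psi> i)) = snd (\<psi> i)}" for i
  show thesis
  proof (rule that[of B])
    show "B i \<subseteq> V" for i by (auto simp: B_def)
    show "card (B i) = q ^ t" if i: "i < q\<^sup>2" for i
    proof -
      obtain x y where xy: "\<psi> i = (x, y)" "x \<in> K" "y \<in> K" using \<psi>_im[OF i] by auto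
      have "\<phi> ` B i = {p \<in> polys_over K (Suc t). poly p x = y}"
        unfolding \<phi>_im[symmetric] B_def xy(1) by auto
      \<comment> \<open>Since \<open>pCons c r\<close> takes the value
        \<open>c + x * poly r x\<close> at \<open>x\<close>, any choice of \<open>r\<close> forces
        the constant coefficient.\<close>
      also have "\<dots> = (\<lambda>r. pCons (y - x * poly r x) r) ` polys_over K t"
        using xy poly_K cl by (auto simp: polys_over_Suc image_iff algebra_simps)
      finally have "card (\<phi> ` B i) = card (polys_over K t)"
        by (simp add: card_image inj_on_def)
      moreover have "inj_on \<phi> (B i)" using \<phi>_inj by (rule inj_on_subset) (auto simp: B_def)
      ultimately show ?thesis using card_polys_over[OF K(1), of t] K by (simp add: card_image)
    qed
    show "card {i. i < q\<^sup>2 \<and> a \<in> B i} \<le> q" for a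
    proof -
      \<comment> \<open>For each \<open>x\<close> there is just one block of the form
        \<open>(x, y)\<close> containing \<open>a\<close>, the one with
        \<open>y = poly (\<phi> a) x\<close>.\<close>
      have "\<psi> ` {i. i < q\<^sup>2 \<and> a \<in> B i} \<subseteq> (\<lambda>x. (x, poly (\<phi> a) x)) ` K"
      proof (rule image_subsetI)
        fix i assume "i \<in> {i. i < q\<^sup>2 \<and> a \<in> B i}"
        then show "\<psi> i \<in> (\<lambda>x. (x, poly (\<phi> a) x)) ` K"
          using \<psi>_im[of i] by (intro rev_image_eqI[of "fst (\<psi> i)"]) (simp_all add: B_def mem_Times_iff prod_eq_iff)
      qed
      then have "card (\<psi> ` {i. i < q\<^sup>2 \<and> a \<in> B i}) \<le> q"
        using surj_card_le[OF K(1)] K(2) by metis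
      moreover have "inj_on \<psi> {i. i < q\<^sup>2 \<and> a \<in> B i}"
        using \<psi>_inj by (rule inj_on_subset) auto
      ultimately show ?thesis by (simp add: card_image)
    qed
    show "card {i. i < q\<^sup>2 \<and> a \<in> B i \<and> b \<in> B i} \<le> t" if "a \<noteq> b" for a b
    proof (cases "a \<in> V \<and> b \<in> V")
      case True
      let ?I = "{i. i < q\<^sup>2 \<and> a \<in> B i \<and> b \<in> B i}"
      \<comment> \<open>A common block of \<open>a\<close> and \<open>b\<close> has as its first
        coordinate a root of the nonzero polynomial \<open>D\<close>, whose degree is at most
        \<open>t\<close>.\<close>
      define D where "D = \<phi> a - \<phi> b"
      have "D \<noteq> 0" using True that \<phi>_inj by (auto simp: D_def inj_on_def)
      have "\<phi> a \<in> polys_over K (Suc t)" "\<phi> b \<in> polys_over K (Suc t)"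
        using True \<phi>_im by auto
      then have "degree D \<le> t" unfolding D_def
        by (intro degree_le) (auto simp: polys_over_def)
      have fin: "finite {x. poly D x = 0}" using \<open>D \<noteq> 0\<close> by (rule poly_roots_finite)
      have "\<psi> ` ?I \<subseteq> (\<lambda>x. (x, poly (\<phi> a) x)) ` {x. poly D x = 0}"
      proof (rule image_subsetI)
        fix i assume "i \<in> ?I"
        then show "\<psi> i \<in> (\<lambda>x. (x, poly (\<phi> a) x)) ` {x. poly D x = 0}"
          by (intro rev_image_eqI[of "fst (\<psi> i)"]) (simp_all add: B_def D_def prod_eq_iff)
      qed
      then have "card (\<psi> ` ?I) \<le> card {x. poly D x = 0}"
        by (rule surj_card_le[OF fin])
      also have "\<dots> \<le> t" using card_poly_roots_bound[OF \<open>D \<noteq> 0\<close>] \<open>degree D \<le> t\<close> by simp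
      also have "card (\<psi> ` ?I) = card ?I"
        by (rule card_image) (rule inj_on_subset[OF \<psi>_inj], auto)
      finally show ?thesis .
    next
      case False
      then have "{i. i < q\<^sup>2 \<and> a \<in> B i \<and> b \<in> B i} = {}" by (auto simp: B_def)
      then show ?thesis by (simp only: card.empty zero_le)
    qed
  qed
qed

subsection \<open>Dense sequences\<close>

text \<open>Sum \<open>alt_length_cases\<close> over the blocks: the single runs cost
  \<open>r\<close> for each symbol, and at most \<open>m\<close> common blocks cost \<open>M\<close>
  each.\<close>

lemma alt_length_concat_design_le:
  fixes B :: "'i \<Rightarrow> 'a set"
  assumes "distinct xs" and "\<And>i. i \<in> set xs \<Longrightarrow> set (f i) \<subseteq> B i"
    and "\<And>i a b. i \<in> set xs \<Longrightarrow> a \<noteq> b \<Longrightarrow> alt_length a b (f i) \<le> M"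
    and deg: "\<And>a. card {i \<in> set xs. a \<in> B i} \<le> r"
    and codeg: "\<And>a b. a \<noteq> b \<Longrightarrow> card {i \<in> set xs. a \<in> B i \<and> b \<in> B i} \<le> m"
    and "a \<noteq> b"
  shows "alt_length a b (concat (map f xs)) \<le> 2 * r + m * M"
proof -
  have "alt_length a b (concat (map f xs)) \<le> (\<Sum>i\<leftarrow>xs. alt_length a b (f i))"
    by (rule alt_length_concat_le)
  also have "\<dots> = (\<Sum>i\<in>set xs. alt_length a b (f i))"
    using assms(1) by (rule sum_list_distinct_conv_sum_set)
  also have "\<dots> \<le> (\<Sum>i\<in>set xs. of_bool (a \<in> B i) + of_bool (b \<in> B i) + of_bool (a \<in> B i \<and> b \<in> B i) * M)"
    using assms(2,3,6) by (intro sum_mono alt_length_cases) auto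
  also have "\<dots> = card {i \<in> set xs. a \<in> B i} + card {i \<in> set xs. b \<in> B i}
      + card {i \<in> set xs. a \<in> B i \<and> b \<in> B i} * M"
    by (simp add: sum.distrib flip: sum_distrib_right Collect_conj_eq) (simp add: Int_def)
  also have "\<dots> \<le> r + r + m * M"
    using deg codeg[OF assms(6)] by (intro add_mono mult_le_mono1) auto
  finally show ?thesis by simp
qed

lemma length_alternation [simp]: "length (alternation a b k) = k"
  by (simp add: alternation_def)

lemma num_steps_alternation: "a \<noteq> b \<Longrightarrow> num_steps (alternation a b k) = k - 1"
  using distinct_adj_alternation[of a b k] by (simp add: num_steps_def distinct_adj_altdef)

text \<open>The words \<open>alternation x y (2 * k)\<close> over all ordered pairs are
  concatenated, with \<open>{x, y}\<close> as blocks. A symbol lies in at most \<open>2 * q\<close>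
  pairs, and two symbols share only \<open>(a, b)\<close> and \<open>(b, a)\<close>, which yields
  \<open>2 * (2 * q) + 2 * (2 * k)\<close>.\<close>

lemma all_pairs_sequence:
  fixes V :: "'a set"
  assumes "finite V" "card V = q" "q \<ge> 2" "k \<ge> 1"
  obtains S where "set S \<subseteq> V" "q\<^sup>2 * k \<le> 2 * num_steps S"
    "\<And>a b. a \<noteq> b \<Longrightarrow> alt_length a b S \<le> 4 * (q + k)"
proof -
  obtain xs where xs: "set xs = V" "distinct xs" using finite_distinct_list[OF assms(1)] by blast
  define L where "L = List.product xs xs"
  have L: "set L = V \<times> V" "distinct L" using xs by (auto simp: L_def distinct_product)
  define f where "f = (\<lambda>(x, y). alternation x y (2 * k) :: 'a list)"
  define S where "S = concat (map f L)"
  have set_f: "set (f p) \<subseteq> {fst p, snd p}" for p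
    by (auto simp: f_def alternation_def split: prod.splits if_splits)
  show thesis
  proof (rule that[of S])
    show "set S \<subseteq> V" using set_f L by (fastforce simp: S_def)
    have diag: "{p \<in> V \<times> V. fst p \<noteq> snd p} = V \<times> V - (\<lambda>x. (x, x)) ` V"
      by auto
    have "card ((\<lambda>x. (x, x)) ` V) = q" using assms(2) by (simp add: card_image inj_on_def)
    then have card_off: "card {p \<in> V \<times> V. fst p \<noteq> snd p} = q * q - q"
      unfolding diag using assms by (subst card_Diff_subset) (auto simp: card_cartesian_product)
    \<comment> \<open>For \<open>q \<ge> 2\<close> at least half of the ordered pairs are off the
      diagonal.\<close>
    have "2 * q \<le> q * q" using assms(3) by simp
    then have "q * q \<le> 2 * (q * q - q)" by linarith
    then have pairs: "q\<^sup>2 * k \<le> 2 * (q * q - q) * k" unfolding power2_eq_square by (rule mult_le_mono1)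
    have "(q * q - q) * k = (\<Sum>p\<in>{p \<in> V \<times> V. fst p \<noteq> snd p}. k)"
      using card_off by simp
    also have "\<dots> = (\<Sum>p\<in>V \<times> V. if fst p \<noteq> snd p then k else 0)"
      using assms(1) by (intro sum.inter_filter) simp
    \<comment> \<open>An off-diagonal pair gives \<open>2 * k - 1 \<ge> k\<close> steps; diagonal
      pairs are estimated by 0.\<close>
    also have "\<dots> \<le> (\<Sum>p\<in>V \<times> V. num_steps (f p))"
      using assms(4) by (intro sum_mono) (auto simp: f_def num_steps_alternation split: prod.splits)
    also have "\<dots> = (\<Sum>p\<leftarrow>L. num_steps (f p))"
      using L by (simp add: sum_list_distinct_conv_sum_set)
    also have "\<dots> \<le> num_steps S" unfolding S_def by (rule num_steps_concat_ge)
    finally show "q\<^sup>2 * k \<le> 2 * num_steps S" using pairs by linarith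
    show "alt_length a b S \<le> 4 * (q + k)" if "a \<noteq> b" for a b
    proof -
      have "alt_length a b S \<le> 2 * (2 * q) + 2 * (2 * k)"
        unfolding S_def
      proof (rule alt_length_concat_design_le[OF L(2), where B = "\<lambda>p. {fst p, snd p}"])
        show "alt_length a b (f p) \<le> 2 * k" for p a b
          using alt_length_le_length[of a b "f p"] by (auto simp: f_def split: prod.splits)
        show "card {p \<in> set L. a \<in> {fst p, snd p}} \<le> 2 * q" for a
        proof -
          have "card {p \<in> set L. a \<in> {fst p, snd p}} \<le> card ({a} \<times> V \<union> V \<times> {a})"
            using assms(1) L by (intro card_mono) auto
          also have "\<dots> \<le> card ({a} \<times> V) + card (V \<times> {a})" by (rule card_Un_le)
          finally show ?thesis using assms(2) by (simp add: card_cartesian_product)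
        qed
        show "card {p \<in> set L. a \<in> {fst p, snd p} \<and> b \<in> {fst p, snd p}} \<le> 2" if "a \<noteq> b" for a b
        proof -
          have "card {p \<in> set L. a \<in> {fst p, snd p} \<and> b \<in> {fst p, snd p}} \<le> card {(a, b), (b, a)}"
            using that by (intro card_mono) auto
          also have "\<dots> = 2" using that by simp
          finally show ?thesis .
        qed
      qed (rule set_f, rule that)
      then show ?thesis by simp
    qed
  qed
qed

text \<open>\<open>C\<close> depends on \<open>t\<close> alone, and \<open>V\<close> is arbitrary so
  that the induction hypothesis applies to every block. The \<open>q\<^sup>2\<close> blocks multiply
  the number of steps by \<open>q\<^sup>2\<close>, while the alternation bound becomes
  \<open>2 * q + Suc t * C * (q + k)\<close>, again linear in \<open>q + k\<close>.\<close>

lemma dense_sequences: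
  "\<exists>C. \<forall>j k. \<forall>V :: 'a set. j \<ge> 1 \<longrightarrow> k \<ge> 1 \<longrightarrow> card V = (2 ^ j) ^ Suc t \<longrightarrow>
     (\<exists>S. set S \<subseteq> V \<and> (2 ^ j) ^ (2 * Suc t) * k \<le> 2 * num_steps S \<and>
        (\<forall>a b. a \<noteq> b \<longrightarrow> alt_length a b S \<le> C * (2 ^ j + k)))"
proof (induction t)
  case 0
  show ?case
  proof (intro exI[of _ 4] allI impI)
    fix j k :: nat and V :: "'a set"
    assume j: "j \<ge> 1" "k \<ge> 1" "card V = (2 ^ j) ^ Suc 0"
    have "(2::nat) ^ 1 \<le> 2 ^ j" using j(1) by (intro power_increasing) auto
    moreover have "finite V" using j(3) by (simp add: card_ge_0_finite)
    ultimately obtain S where "set S \<subseteq> V" "(2 ^ j)\<^sup>2 * k \<le> 2 * num_steps S"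
      "\<And>a b. a \<noteq> b \<Longrightarrow> alt_length a b S \<le> 4 * (2 ^ j + k)"
      using all_pairs_sequence[of V "2 ^ j" k] j by auto
    then show "\<exists>S. set S \<subseteq> V \<and> (2 ^ j) ^ (2 * Suc 0) * k \<le> 2 * num_steps S \<and>
        (\<forall>a b. a \<noteq> b \<longrightarrow> alt_length a b S \<le> 4 * (2 ^ j + k))"
      by (intro exI[of _ S]) simp
  qed
next
  case (Suc t)
  then obtain C where C: "\<And>j k (V :: 'a set). j \<ge> 1 \<Longrightarrow> k \<ge> 1 \<Longrightarrow> card V = (2 ^ j) ^ Suc t \<Longrightarrow>
     \<exists>S. set S \<subseteq> V \<and> (2 ^ j) ^ (2 * Suc t) * k \<le> 2 * num_steps S \<and>
        (\<forall>a b. a \<noteq> b \<longrightarrow> alt_length a b S \<le> C * (2 ^ j + k))"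
    by blast
  show ?case
  proof (intro exI[of _ "2 + Suc t * C"] allI impI)
    fix j k :: nat and V :: "'a set"
    assume j: "j \<ge> 1" "k \<ge> 1" and V: "card V = (2 ^ j) ^ Suc (Suc t)"
    define q :: nat where "q = 2 ^ j"
    have "finite V" using V by (simp add: card_ge_0_finite)
    then obtain B where B: "\<And>i. i < q\<^sup>2 \<Longrightarrow> B i \<subseteq> V" "\<And>i. i < q\<^sup>2 \<Longrightarrow> card (B i) = q ^ Suc t"
      "\<And>a. card {i. i < q\<^sup>2 \<and> a \<in> B i} \<le> q"
      "\<And>a b. a \<noteq> b \<Longrightarrow> card {i. i < q\<^sup>2 \<and> a \<in> B i \<and> b \<in> B i} \<le> Suc t"
      using polynomial_block_design[OF j(1) q_def _ V[folded q_def]] by blast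
    have "\<forall>i\<in>{..<q\<^sup>2}. \<exists>S. set S \<subseteq> B i \<and> q ^ (2 * Suc t) * k \<le> 2 * num_steps S \<and>
        (\<forall>a b. a \<noteq> b \<longrightarrow> alt_length a b S \<le> C * (q + k))"
      using C[OF j] B(2) unfolding q_def by blast
    then obtain f where f: "\<And>i. i < q\<^sup>2 \<Longrightarrow> set (f i) \<subseteq> B i"
      "\<And>i. i < q\<^sup>2 \<Longrightarrow> q ^ (2 * Suc t) * k \<le> 2 * num_steps (f i)"
      "\<And>i a b. i < q\<^sup>2 \<Longrightarrow> a \<noteq> b \<Longrightarrow> alt_length a b (f i) \<le> C * (q + k)"
      unfolding Ball_def by (metis lessThan_iff)
    define S where "S = concat (map f [0..<q\<^sup>2])"
    have "set S \<subseteq> V" using f(1) B(1) by (fastforce simp: S_def)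
    moreover have "q ^ (2 * Suc (Suc t)) * k \<le> 2 * num_steps S"
    proof -
      have "q ^ (2 * Suc (Suc t)) * k = (\<Sum>i<q\<^sup>2. q ^ (2 * Suc t) * k)"
        by (simp add: power_add power2_eq_square)
      also have "\<dots> \<le> (\<Sum>i<q\<^sup>2. 2 * num_steps (f i))" using f(2) by (intro sum_mono) auto
      also have "\<dots> = 2 * (\<Sum>i\<leftarrow>[0..<q\<^sup>2]. num_steps (f i))"
        by (simp add: sum_list_distinct_conv_sum_set sum_distrib_left atLeast0LessThan)
      also have "\<dots> \<le> 2 * num_steps S"
        unfolding S_def by (intro mult_le_mono2 num_steps_concat_ge)
      finally show ?thesis .
    qed
    moreover have "alt_length a b S \<le> (2 + Suc t * C) * (q + k)" if "a \<noteq> b" for a b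
    proof -
      have "alt_length a b S \<le> 2 * q + Suc t * (C * (q + k))"
        unfolding S_def
      proof (rule alt_length_concat_design_le[where B = B])
        show "card {i \<in> set [0..<q\<^sup>2]. a \<in> B i} \<le> q" for a
          using B(3)[of a] by simp
        show "card {i \<in> set [0..<q\<^sup>2]. a \<in> B i \<and> b \<in> B i} \<le> Suc t" if "a \<noteq> b" for a b
          using B(4)[OF that] by simp
        show "set (f i) \<subseteq> B i" if "i \<in> set [0..<q\<^sup>2]" for i
          using f(1) that by simp
        show "alt_length a b (f i) \<le> C * (q + k)" if "i \<in> set [0..<q\<^sup>2]" "a \<noteq> b" for i a b
          using f(3) that by simp
      qed (simp_all add: that)
      also have "\<dots> \<le> (2 + Suc t * C) * (q + k)" by (simp add: algebra_simps)
      finally show ?thesis .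
    qed
    ultimately show "\<exists>S. set S \<subseteq> V \<and> (2 ^ j) ^ (2 * Suc (Suc t)) * k \<le> 2 * num_steps S \<and>
        (\<forall>a b. a \<noteq> b \<longrightarrow> alt_length a b S \<le> (2 + Suc t * C) * (2 ^ j + k))"
      unfolding q_def by blast
  qed
qed

subsection \<open>Asymptotics\<close>

text \<open>The symbols missing from \<open>S\<close> are appended once each.\<close>

lemma pad_sequence:
  assumes "s \<ge> 1" "set S \<subseteq> {..<n}"
    and alt: "\<And>a b. a \<noteq> b \<Longrightarrow> alt_length a b S \<le> s + 1"
  shows "\<exists>T\<in>DS s n. num_steps S \<le> length T"
proof
  define F where "F = sorted_list_of_set ({..<n} - set S)"
  define T where "T = remdups_adj S @ F"
  have F: "distinct F" "set F = {..<n} - set S" by (auto simp: F_def)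
  have dF: "distinct_adj F" using F by (simp add: distinct_adj_altdef remdups_adj_distinct)
  have "last (remdups_adj S) \<noteq> hd F" if "S \<noteq> []" "F \<noteq> []"
  proof -
    have "last S \<in> set S" "hd F \<notin> set S" using that F(2) hd_in_set[of F] by auto
    then show ?thesis unfolding last_remdups_adj by metis
  qed
  then have "distinct_adj T"
    using dF by (auto simp: T_def distinct_adj_append_iff)
  moreover have "\<not> subseq (alternation a b (s + 2)) T" if "a \<noteq> b" for a b
  proof
    assume "subseq (alternation a b (s + 2)) T"
    then have "s + 2 \<le> alt_length a b T" by (rule alternation_subseq_imp_le[OF that])
    also have "\<dots> \<le> alt_length a b (remdups_adj S) + alt_length a b F"
      unfolding T_def by (rule alt_length_append_le)
    also have "\<dots> \<le> alt_length a b S + alt_length a b F"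
      using alt_length_subseq_mono[OF subseq_remdups_adj] by simp
    \<comment> \<open>A pair inside \<open>S\<close> gains nothing from \<open>F\<close>. Any other
      pair has at most two runs in total, which is within \<open>s + 1\<close> because
      \<open>s \<ge> 1\<close>.\<close>
    also have "\<dots> \<le> s + 1"
    proof -
      have 1: "alt_length a b S = 0" if "a \<notin> set S" "b \<notin> set S"
        using alt_length_le_one[of b S a] that by simp
      have "card {x\<in>set F. x = a \<or> x = b} \<le> card {a, b}" by (rule card_mono) auto
      then have "length (filter (\<lambda>x. x = a \<or> x = b) F) \<le> 2"
        using F(1) distinct_card[of "filter (\<lambda>x. x = a \<or> x = b) F"] \<open>a \<noteq> b\<close> by simp
      then have 2: "alt_length a b F \<le> 2"
        unfolding alt_length_def using remdups_adj_length le_trans by blast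
      have 3: "alt_length a b F = 0" if "a \<in> set S" "b \<in> set S"
        using alt_length_le_one[of b F a] that F by simp
      have 4: "alt_length a b S + alt_length a b F \<le> 2" if "a \<in> set S" "b \<notin> set S"
        using alt_length_le_one[of b S a] alt_length_le_one[of a F b] that F
        by (simp add: alt_length_commute[of b a] split: if_splits)
      have 5: "alt_length a b S + alt_length a b F \<le> 2" if "a \<notin> set S" "b \<in> set S"
        using alt_length_le_one[of a S b] alt_length_le_one[of b F a] that F
        by (simp add: alt_length_commute[of b a] split: if_splits)
      show ?thesis
        using 1 2 3 4 5 alt[OF \<open>a \<noteq> b\<close>] \<open>s \<ge> 1\<close> by fastforce
    qed
    finally show False by simp
  qed
  moreover have "set T = {..<n}" using F assms(2) by (auto simp: T_def)
  ultimately show "T \<in> DS s n" by (simp add: DS_def davenport_schinzel_def)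
  show "num_steps S \<le> length T" by (simp add: num_steps_def T_def)
qed

text \<open>\<open>d\<close> and \<open>N\<close> are uniform in \<open>s\<close>, so
  \<open>s\<close> may vary freely with \<open>n\<close>. The budget \<open>s\<close> is split in
  halves: \<open>C * q\<close> and \<open>C * k\<close> are each kept below
  \<open>s / 2\<close>.\<close>

lemma ds_max_lower_bound:
  fixes t :: nat and c :: real
  assumes "t \<ge> 1" "c > 0"
  obtains d N where "d > 0"
    "\<And>n s. n \<ge> N \<Longrightarrow> real s \<ge> c * real n powr (1 / real t) \<Longrightarrow>
       s \<ge> 1 \<and> DS s n \<noteq> {} \<and> real (ds_max s n) \<ge> d * (real n)\<^sup>2 * real s"
proof -
  have "Suc (t - 1) = t" using assms(1) by simp
  from dense_sequences[where 'a = nat and t = "t - 1", unfolded this]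
  obtain C0 where "\<forall>j k. \<forall>V :: nat set. j \<ge> 1 \<longrightarrow> k \<ge> 1 \<longrightarrow> card V = (2 ^ j) ^ t \<longrightarrow>
     (\<exists>S. set S \<subseteq> V \<and> (2 ^ j) ^ (2 * t) * k \<le> 2 * num_steps S \<and>
        (\<forall>a b. a \<noteq> b \<longrightarrow> alt_length a b S \<le> C0 * (2 ^ j + k)))" ..
  note C0 = this[rule_format]
  define C where "C = C0 + 1"
  have C: "C \<ge> 1" "C0 \<le> C" by (auto simp: C_def)
  \<comment> \<open>\<open>\<delta> \<le> 1\<close> ensures \<open>q ^ t \<le> n\<close>, and
    \<open>2 * C * \<delta> \<le> c\<close> ensures \<open>2 * C * q \<le> s\<close>.\<close>
  define \<delta> where "\<delta> = min 1 (c / (2 * real C))"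
  have \<delta>: "\<delta> > 0" "\<delta> \<le> 1" "2 * real C * \<delta> \<le> c"
    using assms(2) C by (auto simp: \<delta>_def min_def field_simps)
  \<comment> \<open>The factors come from \<open>q \<ge> \<delta> * y / 2\<close>, from
    \<open>k \<ge> s / (4 * C)\<close>, and from the 2 in front of \<open>num_steps\<close>.\<close>
  define d where "d = (\<delta> / 2) ^ (2 * t) / (8 * real C)"
  \<comment> \<open>This makes \<open>\<delta> * y \<ge> 2\<close>, so that the largest power of two
    below it has exponent \<open>j \<ge> 1\<close>.\<close>
  define N where "N = nat \<lceil>(2 / \<delta>) ^ t\<rceil>"
  show thesis
  proof (rule that[of d N])
    show "d > 0" using \<delta> C by (simp add: d_def)
    fix n s :: nat assume n: "n \<ge> N" and s: "real s \<ge> c * real n powr (1 / real t)"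
    define y where "y = real n powr (1 / real t)"
    have nN: "real n \<ge> (2 / \<delta>) ^ t" using n by (simp add: N_def nat_le_iff ceiling_le_iff)
    moreover have "(2 / \<delta>) ^ t > 0" using \<delta> by simp
    ultimately have npos: "real n > 0" by linarith
    then have "y > 0" by (simp add: y_def)
    have yt: "y ^ t = real n"
      using npos assms(1) \<open>y > 0\<close> by (simp add: y_def powr_powr flip: powr_realpow)
    have "2 / \<delta> \<le> y"
      using nN \<delta>(1) \<open>y > 0\<close> assms(1) unfolding yt[symmetric] by (subst (asm) power_mono_iff) auto
    then have x2: "2 \<le> \<delta> * y" using \<delta> by (simp add: field_simps)
    define x where "x = nat \<lfloor>\<delta> * y\<rfloor>"
    have "x \<ge> 2" using x2 by (simp add: x_def le_nat_iff le_floor_iff)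
    have x_le: "real x \<le> \<delta> * y" "\<delta> * y < real x + 1"
      using x2 by (auto simp: x_def)
    obtain j where j: "2 ^ j \<le> x" "x < 2 ^ (j + 1)"
      using ex_power_ivl1[of 2 x] \<open>x \<ge> 2\<close> by auto
    have "j \<ge> 1" using j(2) \<open>x \<ge> 2\<close> by (cases j) auto
    define q :: nat where "q = 2 ^ j"
    have q: "real q \<le> \<delta> * y" "\<delta> * y \<le> 2 * real q"
    proof -
      show "real q \<le> \<delta> * y" using j(1) x_le unfolding q_def by (meson of_nat_le_iff order_trans)
      have "x + 1 \<le> 2 * q" using j(2) by (simp add: q_def)
      then show "\<delta> * y \<le> 2 * real q" using x_le(2) by linarith
    qed
    have s_ge: "2 * real C * (\<delta> * y) \<le> real s"
    proof -
      have "2 * real C * \<delta> * y \<le> c * y" using \<delta>(3) \<open>y > 0\<close> by (intro mult_right_mono) auto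
      then show ?thesis using s by (simp add: y_def mult.assoc)
    qed
    have "2 * real C * 2 \<le> 2 * real C * (\<delta> * y)"
      using x2 by (intro mult_left_mono) auto
    with s_ge have "4 * real C \<le> real s" by linarith
    then have s4: "4 * C \<le> s" by linarith
    then have "s \<ge> 1" using C by linarith
    define k where "k = s div (2 * C)"
    have "k \<ge> 1" using s4 C by (simp add: k_def div_greater_zero_iff Suc_le_eq)
    have k_le: "2 * C * k \<le> s" by (simp add: k_def)
    have "s < 2 * C * (k + 1)" using C dividend_less_times_div[of "2 * C" s] by (simp add: k_def)
    \<comment> \<open>As \<open>k \<ge> 1\<close>, rounding down in the division loses at most a
      factor of two.\<close>
    then have k_ge: "s \<le> 4 * C * k"
      using \<open>k \<ge> 1\<close> mult_le_mono2[of 1 k "2 * C"] by (simp add: algebra_simps)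
    have "2 * real C * real q \<le> 2 * real C * (\<delta> * y)"
      using q(1) by (intro mult_left_mono) auto
    with s_ge have "real (2 * C * q) \<le> real s" by simp
    then have "2 * C * q \<le> s" by linarith
    with k_le have Cqk: "C * (q + k) \<le> s" by (simp add: algebra_simps)
    have "real q ^ t \<le> y ^ t"
      using q(1) \<delta> \<open>y > 0\<close> by (intro power_mono) (auto intro: order_trans mult_left_le_one_le)
    then have "real (q ^ t) \<le> real n" by (simp add: yt)
    then have qn: "q ^ t \<le> n" by linarith
    obtain S where S: "set S \<subseteq> {..<q ^ t}" "q ^ (2 * t) * k \<le> 2 * num_steps S"
      "\<And>a b. a \<noteq> b \<Longrightarrow> alt_length a b S \<le> C0 * (q + k)"
      using C0[OF \<open>j \<ge> 1\<close> \<open>k \<ge> 1\<close>, of "{..<q ^ t}"] unfolding q_def by auto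
    have "alt_length a b S \<le> s + 1" if "a \<noteq> b" for a b
      using S(3)[OF that] mult_le_mono1[OF C(2), of "q + k"] Cqk by linarith
    moreover have "set S \<subseteq> {..<n}" using S(1) qn by force
    ultimately obtain T where T: "T \<in> DS s n" "num_steps S \<le> length T"
      using pad_sequence[of s S n] \<open>s \<ge> 1\<close> by blast
    then have "num_steps S \<le> ds_max s n" using length_le_ds_max le_trans by blast
    with S(2) have "q ^ (2 * t) * k \<le> 2 * ds_max s n" by linarith
    then have low: "real q ^ (2 * t) * real k \<le> 2 * real (ds_max s n)"
      by (metis of_nat_le_iff of_nat_mult of_nat_numeral of_nat_power)
    have "(\<delta> / 2) ^ (2 * t) * (real n)\<^sup>2 = (\<delta> * y / 2) ^ (2 * t)"
      by (simp add: power_mult_distrib power_divide power_mult[symmetric] mult.commute[of 2] flip: yt)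
    also have "\<dots> \<le> real q ^ (2 * t)"
      using q(2) \<delta> \<open>y > 0\<close> by (intro power_mono) auto
    finally have "(\<delta> / 2) ^ (2 * t) * (real n)\<^sup>2 * (real s / (4 * real C)) \<le> real q ^ (2 * t) * real k"
    proof (rule mult_mono)
      have "real s \<le> real (4 * C * k)" using k_ge by (simp only: of_nat_le_iff)
      then show "real s / (4 * real C) \<le> real k" using C by (simp add: field_simps)
    qed auto
    with low have "(\<delta> / 2) ^ (2 * t) * (real n)\<^sup>2 * (real s / (4 * real C)) \<le> 2 * real (ds_max s n)"
      by linarith
    then have "d * (real n)\<^sup>2 * real s \<le> real (ds_max s n)"
      using C by (simp add: d_def field_simps)
    then show "s \<ge> 1 \<and> DS s n \<noteq> {} \<and> real (ds_max s n) \<ge> d * (real n)\<^sup>2 * real s"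
      using T \<open>s \<ge> 1\<close> by auto
  qed
qed

theorem theorem4:
  fixes t :: nat and s :: "nat \<Rightarrow> nat"
  assumes "t \<ge> 1"
    and "(\<lambda>n. real (s n)) \<in> \<Omega>(\<lambda>n. real n powr (1 / real t) * fact (t - 1))"
  shows "(\<lambda>n. real (ds_max (s n) n)) \<in> \<Omega>(\<lambda>n. (real n)\<^sup>2 * real (s n) / fact (t - 1)) \<and>
         (\<lambda>n. real (ds_max (s n) n)) \<in> O(\<lambda>n. (real n)\<^sup>2 * real (s n))"
proof -
  obtain c where c: "c > 0"
    "eventually (\<lambda>n. norm (real (s n)) \<ge> c * norm (real n powr (1 / real t) * fact (t - 1))) at_top"
    using assms(2) by (rule landau_omega.bigE)
  obtain d N where d: "d > 0" and low: "\<And>n s. n \<ge> N \<Longrightarrow> real s \<ge> c * real n powr (1 / real t) \<Longrightarrow>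
       s \<ge> 1 \<and> DS s n \<noteq> {} \<and> real (ds_max s n) \<ge> d * (real n)\<^sup>2 * real s"
    using ds_max_lower_bound[OF assms(1) c(1)] by blast
  \<comment> \<open>Besides the lower bound, this supplies the nonemptiness of
    \<open>DS (s n) n\<close> that gives \<open>Max\<close> a meaning in the upper bound.\<close>
  have ev: "eventually (\<lambda>n. n \<ge> 1 \<and> s n \<ge> 1 \<and> DS (s n) n \<noteq> {} \<and>
      real (ds_max (s n) n) \<ge> d * (real n)\<^sup>2 * real (s n)) at_top"
    using c(2) eventually_ge_at_top[of N] eventually_ge_at_top[of 1]
  proof eventually_elim
    case (elim n)
    have "c * real n powr (1 / real t) * 1 \<le> c * real n powr (1 / real t) * fact (t - 1)"
      using c(1) by (intro mult_left_mono fact_ge_1) auto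
    with elim(1) have "c * real n powr (1 / real t) \<le> real (s n)" by (simp add: mult.assoc)
    with low[OF elim(2)] elim(3) show ?case by blast
  qed
  have "(\<lambda>n. real (ds_max (s n) n)) \<in> \<Omega>(\<lambda>n. (real n)\<^sup>2 * real (s n) / fact (t - 1))"
  proof (rule landau_omega.bigI[OF d])
    show "eventually (\<lambda>n. norm (real (ds_max (s n) n)) \<ge>
        d * norm ((real n)\<^sup>2 * real (s n) / fact (t - 1))) at_top"
      using ev
    proof eventually_elim
      case (elim n)
      have "d * ((real n)\<^sup>2 * real (s n) / fact (t - 1)) \<le> d * ((real n)\<^sup>2 * real (s n) / 1)"
        using d by (intro mult_left_mono divide_left_mono fact_ge_1) auto
      with elim show ?case by (simp add: mult.assoc)
    qed
  qed
  moreover have "(\<lambda>n. real (ds_max (s n) n)) \<in> O(\<lambda>n. (real n)\<^sup>2 * real (s n))"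
  proof (rule landau_o.bigI[of 2])
    show "eventually (\<lambda>n. norm (real (ds_max (s n) n)) \<le> 2 * norm ((real n)\<^sup>2 * real (s n))) at_top"
      using ev
    proof eventually_elim
      case (elim n)
      \<comment> \<open>The additive 1 of the upper bound is absorbed here, which accounts for the
        constant 2.\<close>
      then have "1 \<le> n\<^sup>2 * s n" by simp
      with ds_max_le[of "s n" n] elim have "ds_max (s n) n \<le> 2 * (n\<^sup>2 * s n)" by linarith
      then have "real (ds_max (s n) n) \<le> real (2 * (n\<^sup>2 * s n))" by (simp only: of_nat_le_iff)
      then show ?case by simp
    qed
  qed simp
  ultimately show ?thesis ..
qed

end
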